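(* For every even integer $d>2$ there exists a positive integer $N(d)$ such that for every $n\ge N(d)$, every optimal binary $(n,M,\{d,d+2\})$-code $C$ is isomorphic to a constant-weight code of weight $\frac{d}{2}+1$; that is, there is a vector $y\in\{0,1\}^n$ such that every word of $C+y=\{x+y: x\in C\}$ has Hamming weight exactly $\frac{d}{2}+1$.
   Context: A binary code of length $n$ is a subset $C\subseteq\{0,1\}^n$, with Hamming distance $d(\cdot,\cdot)$ and addition modulo 2. $C$ is an $(n,M,\{d_1,d_2\})$-code if $|C|=M$ and $\{d(u,v): u,v\in C,\ u\ne v\}=\{d_1,d_2\}$. $A_2(n,\{d_1,d_2\})$ is the maximum size of such a code; a code is optimal if $|C|=A_2(n,\{d_1,d_2\})$. Isomorphism here means the code is obtained by a translation $x\mapsto x+y$ (which preserves all distances). *)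

theory Defs
  imports "HOL-Library.Z2" "Jordan_Normal_Form.Matrix"
begin

definition hamming_dist :: "bit vec \<Rightarrow> bit vec \<Rightarrow> nat" where
  "hamming_dist u v = card {i. i < dim_vec u \<and> u $ i \<noteq> v $ i}"

definition hamming_weight :: "bit vec \<Rightarrow> nat" where
  "hamming_weight v = card {i. i < dim_vec v \<and> v $ i \<noteq> 0}"

text \<open>Every distance in \<open>D\<close> must be attained, not merely allowed.\<close>

definition binary_code :: "nat \<Rightarrow> nat \<Rightarrow> nat set \<Rightarrow> bit vec set \<Rightarrow> bool" where
  "binary_code n M D C \<longleftrightarrow>
     C \<subseteq> carrier_vec n \<and> card C = M \<and>
     {hamming_dist u v | u v. u \<in> C \<and> v \<in> C \<and> u \<noteq> v} = D"

text \<open>The set of sizes is finite, being bounded by \<open>2 ^ n\<close>. If no code with distance set \<open>D\<close>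
  exists then the maximum is unspecified, but then there are no optimal codes either.\<close>

definition A2 :: "nat \<Rightarrow> nat set \<Rightarrow> nat" where
  "A2 n D = Max {M. \<exists>C. binary_code n M D C}"

definition optimal_code :: "nat \<Rightarrow> nat \<Rightarrow> nat set \<Rightarrow> bit vec set \<Rightarrow> bool" where
  "optimal_code n M D C \<longleftrightarrow> binary_code n M D C \<and> M = A2 n D"

definition translate_code :: "bit vec set \<Rightarrow> bit vec \<Rightarrow> bit vec set" where
  "translate_code C y = (\<lambda>x. x + y) ` C"

definition constant_weight :: "nat \<Rightarrow> bit vec set \<Rightarrow> bool" where
  "constant_weight w C \<longleftrightarrow> (\<forall>x\<in>C. hamming_weight x = w)"

end

theory Submission
  imports Defs
begin

text \<open>
  Identify words with subsets of \<open>{..<n}\<close> and put \<open>d = 2 k\<close>. Packings, i.e. families of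
  \<open>(k + 1)\<close>-sets with pairwise intersections of size at most one, are codes with distances \<open>d\<close> and
  \<open>d + 2\<close>, and there are packings with quadratically many blocks, so an optimal code is quadratically
  large.

  Translate the code so that it contains the empty set, take the more frequent of the weights \<open>2 k\<close>
  and \<open>2 k + 2\<close>, call it \<open>w\<close>, and fix a word \<open>a\<close> of weight \<open>w\<close>. Some \<open>T \<subseteq> a\<close> is the trace on \<open>a\<close> of
  more than linearly many words of weight \<open>w\<close>; this forces \<open>|T| = w - k - 1\<close>, since for
  \<open>|T| = w - k\<close> these words are disjoint outside \<open>T\<close>. After translation by \<open>T\<close> they form a packing.
  Every other word is bounded, so it misses some block of this packing and must have weight \<open>k + 1\<close> or
  \<open>k - 1\<close>.

  At most one word \<open>Q\<close> has weight \<open>k - 1\<close>, and it is disjoint from all blocks. Its \<open>k - 1 > 0\<close>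
  points are therefore unused, and they allow the packing to be improved: pick a generic
  \<open>(k + 1)\<close>-set \<open>K\<close>; in every block that contains a pair of points of \<open>K\<close>, replace one of the two by a
  point of \<open>Q\<close>; then \<open>K\<close> itself can be added as a block. Doing this twice beats the original code.
\<close>

section \<open>Counting in families of finite sets\<close>

lemma card_sym_diff_plus:
  assumes "finite A" "finite B"
  shows "card (sym_diff A B) + 2 * card (A \<inter> B) = card A + card B"
proof -
  have "card (sym_diff A B) = card (A - B) + card (B - A)"
    using assms by (intro card_Un_disjoint) auto
  moreover have "card A = card (A - B) + card (A \<inter> B)"
    using card_Int_Diff[OF assms(1), of B] by simp
  moreover have "card B = card (B - A) + card (A \<inter> B)"
    using card_Int_Diff[OF assms(2), of A] by (simp add: Int_commute)
  ultimately show ?thesis by simp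
qed

text \<open>Disjoint nonempty sets have different minima, so \<open>Min\<close> embeds the family in
  \<open>{..<n}\<close>. The linear bounds below rest on this.\<close>

lemma card_pairwise_disjoint_le:
  assumes "\<F> \<subseteq> Pow {..<n::nat}" "{} \<notin> \<F>"
    and "\<And>A B. A \<in> \<F> \<Longrightarrow> B \<in> \<F> \<Longrightarrow> A \<noteq> B \<Longrightarrow> A \<inter> B = {}"
  shows "card \<F> \<le> n"
proof -
  have fin: "finite A" if "A \<in> \<F>" for A
    by (rule finite_subset[of A "{..<n}"]) (use that assms(1) in auto)
  have Min: "Min A \<in> A" if "A \<in> \<F>" for A
    by (rule Min_in[OF fin[OF that]]) (use that assms(2) in auto)
  have "inj_on Min \<F>"
  proof (rule inj_onI)
    fix A B assume AB: "A \<in> \<F>" "B \<in> \<F>" "Min A = Min B"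
    then have "Min A \<in> A \<inter> B" using Min[of A] Min[of B] by simp
    then show "A = B" using assms(3)[of A B] AB by blast
  qed
  moreover have "Min ` \<F> \<subseteq> {..<n}" using Min assms(1) by blast
  ultimately have "card \<F> \<le> card {..<n}" by (rule card_inj_on_le) simp
  then show ?thesis by simp
qed

section \<open>Packings: degrees and block intersections\<close>

text \<open>These are partial Steiner systems \<open>S(2, k + 1, n)\<close>: a pair of points lies
  in at most one block. Two blocks are at distance
  \<open>2 * k + 2 - 2 * card (B \<inter> B')\<close>, so intersections of size 0 and 1 match the
  distances \<open>d + 2\<close> and \<open>d\<close> for \<open>d = 2 * k\<close>.\<close>

definition packing :: "nat \<Rightarrow> nat \<Rightarrow> nat set set \<Rightarrow> bool" where
  "packing k n P \<longleftrightarrow> P \<subseteq> Pow {..<n} \<and> (\<forall>B\<in>P. card B = k + 1) \<and>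
     (\<forall>B\<in>P. \<forall>B'\<in>P. B \<noteq> B' \<longrightarrow> card (B \<inter> B') \<le> 1)"

lemma packing_finite: "packing k n P \<Longrightarrow> finite P"
  unfolding packing_def by (meson finite_Pow_iff finite_lessThan finite_subset)

lemma packing_finite_block: "packing k n P \<Longrightarrow> B \<in> P \<Longrightarrow> finite B"
  unfolding packing_def by (meson PowD finite_lessThan finite_subset subsetD)

lemma packing_block_eqI:
  assumes "packing k n P" "B \<in> P" "B' \<in> P" "x \<in> B \<inter> B'" "y \<in> B \<inter> B'" "x \<noteq> y"
  shows "B = B'"
proof (rule ccontr)
  assume "B \<noteq> B'"
  then have "card (B \<inter> B') \<le> 1" using assms unfolding packing_def by blast
  moreover have "finite (B \<inter> B')" using packing_finite_block assms by blast
  ultimately show False using assms(4-6) card_le_Suc0_iff_eq by (metis One_nat_def)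
qed

text \<open>Distinct blocks through \<open>x\<close> share no other point, so deleting
  \<open>x\<close> makes them disjoint; they stay nonempty since \<open>k \<ge> 1\<close>.\<close>

lemma packing_degree_le:
  assumes "packing k n P" "k \<ge> 1"
  shows "card {B\<in>P. x \<in> B} \<le> n"
proof -
  let ?D = "{B\<in>P. x \<in> B}"
  have "inj_on (\<lambda>B. B - {x}) ?D" by (rule inj_onI) blast
  then have "card ?D = card ((\<lambda>B. B - {x}) ` ?D)" by (simp add: card_image)
  also have "\<dots> \<le> n"
  proof (rule card_pairwise_disjoint_le)
    show "(\<lambda>B. B - {x}) ` ?D \<subseteq> Pow {..<n}" using assms(1) unfolding packing_def by auto
    show "{} \<notin> (\<lambda>B. B - {x}) ` ?D"
    proof
      assume "{} \<in> (\<lambda>B. B - {x}) ` ?D"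
      then obtain B where "B \<in> P" "B = {x}" by blast
      then have "card {x} = k + 1" using assms(1) unfolding packing_def by blast
      then show False using assms(2) by simp
    qed
    show "A \<inter> B = {}"
      if A: "A \<in> (\<lambda>B. B - {x}) ` ?D" and B: "B \<in> (\<lambda>B. B - {x}) ` ?D" and ne: "A \<noteq> B" for A B
    proof (rule ccontr)
      assume "A \<inter> B \<noteq> {}"
      then obtain y where y: "y \<in> A" "y \<in> B" by blast
      obtain A' B' where "A' \<in> P" "x \<in> A'" "A = A' - {x}" "B' \<in> P" "x \<in> B'" "B = B' - {x}"
        using A B by blast
      then show False using packing_block_eqI[OF assms(1), of A' B' x y] y ne by blast
    qed
  qed
  finally show ?thesis .
qed

text \<open>A union bound over the points of \<open>S\<close>. For \<open>S\<close> of bounded size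
  it is linear in \<open>n\<close>, so a larger packing has a block that avoids
  \<open>S\<close>.\<close>

lemma packing_meeting_le:
  assumes "packing k n P" "k \<ge> 1" "finite S"
  shows "card {B\<in>P. B \<inter> S \<noteq> {}} \<le> card S * n"
proof -
  have "{B\<in>P. B \<inter> S \<noteq> {}} = (\<Union>x\<in>S. {B\<in>P. x \<in> B})" by auto
  then have "card {B\<in>P. B \<inter> S \<noteq> {}} \<le> (\<Sum>x\<in>S. card {B\<in>P. x \<in> B})"
    using card_UN_le[OF assms(3)] by simp
  also have "\<dots> \<le> (\<Sum>x\<in>S. n)" by (intro sum_mono packing_degree_le[OF assms(1,2)])
  finally show ?thesis by simp
qed

lemma packing_disjoint_block:
  assumes "packing k n P" "k \<ge> 1" "finite S" "card P > card S * n"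
  shows "\<exists>B\<in>P. B \<inter> S = {}"
proof (rule ccontr)
  assume "\<not> ?thesis"
  then have "{B\<in>P. B \<inter> S \<noteq> {}} = P" by auto
  then show False using packing_meeting_le[OF assms(1-3)] assms(4) by simp
qed

text \<open>Supplies witnesses for both distances, which \<open>binary_code\<close> wants attained.
  A block missing a given one exists by the degree bound; if no two blocks met, there would be at
  most \<open>n\<close> of them.\<close>

lemma packing_intersections:
  assumes "packing k n P" "k \<ge> 1" "card P > (k + 1) * n"
  shows "\<exists>A\<in>P. \<exists>B\<in>P. A \<noteq> B \<and> card (A \<inter> B) = 0"
    and "\<exists>A\<in>P. \<exists>B\<in>P. A \<noteq> B \<and> card (A \<inter> B) = 1"
proof -
  have "P \<noteq> {}" using assms(3) by auto
  then obtain A where A: "A \<in> P" by auto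
  have cA: "card A = k + 1" using A assms(1) unfolding packing_def by blast
  then have "card P > card A * n" using assms(3) by simp
  then obtain B where B: "B \<in> P" "B \<inter> A = {}"
    using packing_disjoint_block[OF assms(1,2) packing_finite_block[OF assms(1) A]] by blast
  then have "A \<noteq> B" using cA by auto
  moreover have "card (A \<inter> B) = 0" using B(2) by (simp add: Int_commute)
  ultimately show "\<exists>A\<in>P. \<exists>B\<in>P. A \<noteq> B \<and> card (A \<inter> B) = 0" using A B(1) by blast
  show "\<exists>A\<in>P. \<exists>B\<in>P. A \<noteq> B \<and> card (A \<inter> B) = 1"
  proof (rule ccontr)
    assume neg: "\<not> ?thesis"
    have "A \<inter> B = {}" if "A \<in> P" "B \<in> P" "A \<noteq> B" for A B
    proof -
      have "card (A \<inter> B) \<le> 1" using that assms(1) unfolding packing_def by blast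
      moreover have "card (A \<inter> B) \<noteq> 1" using neg that by blast
      ultimately have "card (A \<inter> B) = 0" by linarith
      then show ?thesis using packing_finite_block[OF assms(1)] that by simp
    qed
    moreover have "{} \<notin> P"
    proof
      assume "{} \<in> P"
      then have "card ({} :: nat set) = k + 1" using assms(1) unfolding packing_def by blast
      then show False by simp
    qed
    moreover have "P \<subseteq> Pow {..<n}" using assms(1) unfolding packing_def by blast
    ultimately have "card P \<le> n" by (intro card_pairwise_disjoint_le)
    also have "\<dots> \<le> (k + 1) * n" by simp
    finally show False using assms(3) by simp
  qed
qed

section \<open>Packings with quadratically many blocks\<close>

text \<open>The blocks are the lines \<open>i \<mapsto> a + b * i\<close> over the integers, with the point
  \<open>(i, v)\<close> encoded as \<open>i * ((k + 1) * m) + v\<close>.\<close>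

lemma packing_quadratic_exists:
  assumes "(k + 1) * ((k + 1) * m) \<le> n" "k \<ge> 1"
  shows "\<exists>P. packing k n P \<and> card P = m * m"
proof -
  define L where "L = (k + 1) * m"
  define blk where "blk = (\<lambda>(a, b). (\<lambda>i. i * L + (a + b * i)) ` {..k})"
  have lt: "a + b * i < L" if "a < m" "b < m" "i \<le> k" for a b i
  proof -
    have "b * i \<le> (m - 1) * k" using that by (intro mult_mono) auto
    then have "a + b * i \<le> (m - 1) + (m - 1) * k" using that by linarith
    also have "\<dots> = (k + 1) * (m - 1)" by (cases m) (auto simp: algebra_simps)
    also have "\<dots> < L" unfolding L_def by (intro mult_strict_left_mono) (use that in auto)
    finally show ?thesis .
  qed
  have dec: "i = j \<and> u = v" if "i * L + u = j * L + v" "u < L" "v < L" for i j u v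
  proof -
    have "(i * L + u) div L = i" "(j * L + v) div L = j" using that(2,3) by auto
    then have "i = j" using that(1) by metis
    then show ?thesis using that(1) by simp
  qed
  have card_blk: "card (blk (a, b)) = k + 1" if "a < m" "b < m" for a b
  proof -
    have "inj_on (\<lambda>i. i * L + (a + b * i)) {..k}"
      by (rule inj_onI) (metis dec lt that atMost_iff)
    then show ?thesis unfolding blk_def by (simp add: card_image)
  qed
  have inter: "card (blk (a, b) \<inter> blk (a', b')) \<le> 1"
    if *: "a < m" "b < m" "a' < m" "b' < m" and ne: "(a, b) \<noteq> (a', b')" for a b a' b'
  proof (rule ccontr)
    assume "\<not> ?thesis"
    moreover have "finite (blk (a, b) \<inter> blk (a', b'))" unfolding blk_def by auto
    ultimately obtain x y where xy: "x \<in> blk (a, b) \<inter> blk (a', b')" "y \<in> blk (a, b) \<inter> blk (a', b')" "x \<noteq> y"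
      by (metis One_nat_def card_le_Suc0_iff_eq)
    have ex: "\<exists>i\<le>k. z = i * L + (a + b * i) \<and> a + b * i = a' + b' * i"
      if "z \<in> blk (a, b) \<inter> blk (a', b')" for z
    proof -
      obtain i j where ij: "i \<le> k" "j \<le> k" "z = i * L + (a + b * i)" "z = j * L + (a' + b' * j)"
        using \<open>z \<in> _\<close> unfolding blk_def by auto
      then have "i = j \<and> a + b * i = a' + b' * j"
        using dec[of i "a + b * i" j "a' + b' * j"] lt * by metis
      then show ?thesis using ij by blast
    qed
    obtain i where i: "x = i * L + (a + b * i)" "a + b * i = a' + b' * i" using ex[OF xy(1)] by auto
    obtain j where j: "y = j * L + (a + b * j)" "a + b * j = a' + b' * j" using ex[OF xy(2)] by auto
    have "i \<noteq> j" using i(1) j(1) xy(3) by auto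
    \<comment> \<open>Lines that agree at two abscissae have equal slopes; in \<open>int\<close> the
      difference of the two equations factors.\<close>
    have "int a + int b * int i = int a' + int b' * int i" "int a + int b * int j = int a' + int b' * int j"
      using i(2) j(2) by (metis of_nat_add of_nat_mult)+
    then have "(int b - int b') * (int i - int j) = 0" by (simp add: algebra_simps)
    then have "b = b'" using \<open>i \<noteq> j\<close> by auto
    then show False using i(2) ne by simp
  qed
  define P where "P = blk ` ({..<m} \<times> {..<m})"
  have inj: "inj_on blk ({..<m} \<times> {..<m})"
  proof (rule inj_onI, rule ccontr)
    fix p q assume pq: "p \<in> {..<m} \<times> {..<m}" "q \<in> {..<m} \<times> {..<m}" "blk p = blk q" "p \<noteq> q"
    obtain a b a' b' where ab: "p = (a, b)" "q = (a', b')" by fastforce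
    then have "card (blk p \<inter> blk q) \<le> 1" using inter[of a b a' b'] pq by auto
    moreover have "card (blk p) = k + 1" using card_blk[of a b] pq ab by auto
    ultimately show False using pq(3) assms(2) by simp
  qed
  have "packing k n P"
    unfolding packing_def
  proof (intro conjI ballI impI)
    show "P \<subseteq> Pow {..<n}"
    proof
      fix B assume "B \<in> P"
      then obtain a b where ab: "a < m" "b < m" "B = blk (a, b)" unfolding P_def by auto
      have "i * L + (a + b * i) < n" if "i \<le> k" for i
      proof -
        have "i * L + (a + b * i) < i * L + L" using lt ab that by simp
        also have "\<dots> = (i + 1) * L" by simp
        also have "\<dots> \<le> (k + 1) * L" using that by (intro mult_right_mono) auto
        finally show ?thesis using assms(1) unfolding L_def by linarith
      qed
      then show "B \<in> Pow {..<n}" using ab unfolding blk_def by auto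
    qed
    show "card B = k + 1" if "B \<in> P" for B using that card_blk unfolding P_def by auto
    show "card (B \<inter> B') \<le> 1" if B: "B \<in> P" "B' \<in> P" and ne: "B \<noteq> B'" for B B'
    proof -
      obtain a b a' b' where "a < m" "b < m" "a' < m" "b' < m" "B = blk (a, b)" "B' = blk (a', b')"
        using B unfolding P_def by auto
      then show ?thesis using inter ne by metis
    qed
  qed
  moreover have "card P = m * m" unfolding P_def using inj by (simp add: card_image card_cartesian_product)
  ultimately show ?thesis by blast
qed

section \<open>Generic blocks by greedy choice\<close>

text \<open>One greedy step: a set of size \<open>s\<close> gains a point, then at most
  \<open>(s + 1)^2\<close> blocks of \<open>k + 1\<close> points each. \<open>D\<close> bounds the
  initial set, and the result is independent of \<open>n\<close>.\<close>

primrec growth :: "nat \<Rightarrow> nat \<Rightarrow> nat \<Rightarrow> nat" where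
  "growth k D 0 = D"
| "growth k D (Suc j) = (growth k D j + 1) + (growth k D j + 1)\<^sup>2 * (k + 1)"

text \<open>\<open>K\<close> grows point by point, each new point lying outside the closure of the
  current \<open>S\<close>, so that a block through it meets this \<open>S\<close> at most once.
  Hence no block acquires three points of \<open>K\<close>, and blocks that contain a pair of
  \<open>K\<close> avoid \<open>Z\<close> and meet each other only inside \<open>K\<close>. The
  bounded set \<open>S\<close> collects these blocks.\<close>

lemma packing_generic_block:
  assumes P: "packing k n P" and Z: "Z \<subseteq> {..<n}" "card Z \<le> D"
    and n: "growth k D j < n"
  shows "\<exists>K S. Z \<subseteq> S \<and> K \<subseteq> S \<and> S \<subseteq> {..<n} \<and> K \<inter> Z = {} \<and> card K = j \<and>
    card S \<le> growth k D j \<and>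
    (\<forall>B\<in>P. card (B \<inter> K) \<ge> 2 \<longrightarrow> B \<subseteq> S \<and> card (B \<inter> K) = 2 \<and> B \<inter> Z = {}) \<and>
    (\<forall>B\<in>P. \<forall>B'\<in>P. card (B \<inter> K) \<ge> 2 \<longrightarrow> card (B' \<inter> K) \<ge> 2 \<longrightarrow> B \<noteq> B' \<longrightarrow> B \<inter> B' \<subseteq> K)"
  using n
proof (induction j)
  case 0
  then show ?case using Z by (intro exI[of _ "{}"] exI[of _ Z]) auto
next
  case (Suc j)
  define g where "g = (\<lambda>s::nat. (s + 1) + (s + 1)\<^sup>2 * (k + 1))"
  have g_Suc: "growth k D (Suc j) = g (growth k D j)" unfolding g_def by simp
  have g_ge: "s \<le> g s" for s unfolding g_def by simp
  have g_mono: "g s \<le> g t" if "s \<le> t" for s t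
    unfolding g_def using that by (intro add_mono mult_right_mono power_mono) auto
  have nlt: "g (growth k D j) < n" using Suc.prems g_Suc by simp
  then have "growth k D j < n" using g_ge[of "growth k D j"] by linarith
  from Suc.IH[OF this] obtain K S where KS: "Z \<subseteq> S" "K \<subseteq> S" "S \<subseteq> {..<n}" "K \<inter> Z = {}" "card K = j"
    and cS: "card S \<le> growth k D j"
    and R: "\<forall>B\<in>P. card (B \<inter> K) \<ge> 2 \<longrightarrow> B \<subseteq> S \<and> card (B \<inter> K) = 2 \<and> B \<inter> Z = {}"
    and RR: "\<forall>B\<in>P. \<forall>B'\<in>P. card (B \<inter> K) \<ge> 2 \<longrightarrow> card (B' \<inter> K) \<ge> 2 \<longrightarrow> B \<noteq> B' \<longrightarrow> B \<inter> B' \<subseteq> K"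
    by (elim exE conjE)
  \<comment> \<open>A single round of closure: \<open>cl\<close> is not iterated, which keeps its
    size polynomial in \<open>card T\<close>.\<close>
  define cl where "cl = (\<lambda>T. T \<union> \<Union>{B\<in>P. card (B \<inter> T) \<ge> 2})"
  have cl_sub: "cl T \<subseteq> {..<n}" if "T \<subseteq> {..<n}" for T
    using that P unfolding cl_def packing_def by blast
  have cl_card: "card (cl T) \<le> card T + (card T)\<^sup>2 * (k + 1)" if "T \<subseteq> {..<n}" for T
  proof -
    have finT: "finite T" using that finite_subset by blast
    let ?blocks = "{B\<in>P. card (B \<inter> T) \<ge> 2}"
    have ex: "\<exists>p. p \<in> T \<times> T \<and> fst p \<noteq> snd p \<and> fst p \<in> B \<and> snd p \<in> B" if "B \<in> ?blocks" for B
    proof -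
      have "finite (B \<inter> T)" using finT by simp
      moreover have "\<not> card (B \<inter> T) \<le> Suc 0" using that by simp
      ultimately obtain x y where "x \<in> B \<inter> T" "y \<in> B \<inter> T" "x \<noteq> y" using card_le_Suc0_iff_eq by blast
      then show ?thesis by (intro exI[of _ "(x, y)"]) auto
    qed
    \<comment> \<open>Two distinct points of \<open>T\<close> determine the block through them;
      ordered pairs are chosen, hence the square.\<close>
    define f where "f = (\<lambda>B. SOME p. p \<in> T \<times> T \<and> fst p \<noteq> snd p \<and> fst p \<in> B \<and> snd p \<in> B)"
    have f: "f B \<in> T \<times> T \<and> fst (f B) \<noteq> snd (f B) \<and> fst (f B) \<in> B \<and> snd (f B) \<in> B"
      if "B \<in> ?blocks" for B
      unfolding f_def by (rule someI_ex[OF ex[OF that]])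
    have "inj_on f ?blocks"
    proof (rule inj_onI)
      fix A B assume AB: "A \<in> ?blocks" "B \<in> ?blocks" "f A = f B"
      have "fst (f A) \<in> A \<inter> B" "snd (f A) \<in> A \<inter> B" "fst (f A) \<noteq> snd (f A)"
        using f[OF AB(1)] f[OF AB(2)] AB(3) by auto
      then show "A = B" using packing_block_eqI[OF P] AB(1,2) by blast
    qed
    moreover have "f ` ?blocks \<subseteq> T \<times> T" using f by blast
    ultimately have "card ?blocks \<le> card (T \<times> T)" using card_inj_on_le finT by blast
    then have cb: "card ?blocks \<le> (card T)\<^sup>2" by (simp add: card_cartesian_product power2_eq_square)
    have "card (cl T) \<le> card T + card (\<Union>?blocks)" unfolding cl_def by (rule card_Un_le)
    also have "card (\<Union>?blocks) \<le> (\<Sum>B\<in>?blocks. card B)" by (rule card_Union_le_sum_card)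
    also have "(\<Sum>B\<in>?blocks. card B) = (\<Sum>B\<in>?blocks. k + 1)"
      using P unfolding packing_def by (intro sum.cong) auto
    also have "\<dots> = card ?blocks * (k + 1)" by simp
    also have "\<dots> \<le> (card T)\<^sup>2 * (k + 1)" using cb by (intro mult_right_mono) auto
    finally show ?thesis by simp
  qed
  have finS: "finite S" using KS(3) finite_subset by blast
  have "card (cl S) \<le> card S + (card S)\<^sup>2 * (k + 1)" using cl_card KS(3) by blast
  also have "\<dots> \<le> g (card S)" unfolding g_def by (intro add_mono mult_right_mono power_mono) auto
  also have "\<dots> \<le> g (growth k D j)" using g_mono cS by blast
  finally have "card (cl S) < n" using nlt by simp
  then obtain x where x: "x < n" "x \<notin> cl S"
    using cl_sub[OF KS(3)] by (metis card_lessThan lessThan_iff less_irrefl subsetI subset_antisym)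
  have xS: "x \<notin> S" using x unfolding cl_def by blast
  have xB: "card (B \<inter> S) \<le> 1" if "B \<in> P" "x \<in> B" for B
  proof -
    have "\<not> card (B \<inter> S) \<ge> 2" using x(2) that unfolding cl_def by blast
    then show ?thesis by linarith
  qed
  define S' where "S' = cl (insert x S)"
  define K' where "K' = insert x K"
  have cS': "card S' \<le> growth k D (Suc j)"
  proof -
    have "card (insert x S) = card S + 1" using xS finS by simp
    then have "card S' \<le> (card S + 1) + (card S + 1)\<^sup>2 * (k + 1)"
      using cl_card[of "insert x S"] KS(3) x(1) unfolding S'_def by simp
    then show ?thesis using g_mono[OF cS] g_Suc unfolding g_def by linarith
  qed
  \<comment> \<open>A block that acquires its pair only with \<open>x\<close> has exactly two points
    in \<open>insert x S\<close>: \<open>x\<close> and a point of \<open>K\<close>.\<close>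
  have new: "x \<in> B \<and> (\<exists>y\<in>K. B \<inter> S = {y})" if B: "B \<in> P" "card (B \<inter> K') \<ge> 2" "\<not> card (B \<inter> K) \<ge> 2" for B
  proof -
    have xin: "x \<in> B"
    proof (rule ccontr)
      assume "x \<notin> B"
      then have "B \<inter> K' = B \<inter> K" unfolding K'_def by blast
      then show False using B by simp
    qed
    have finB: "finite B" using packing_finite_block[OF P B(1)] .
    have "B \<inter> K' = insert x (B \<inter> K)" using xin unfolding K'_def by blast
    then have "card (B \<inter> K') \<le> Suc (card (B \<inter> K))" by (simp add: card_insert_le_m1 card_insert_if finB)
    then have "card (B \<inter> K) \<noteq> 0" using B(2) by linarith
    then obtain y where y: "y \<in> B" "y \<in> K" by (metis card.empty Int_iff ex_in_conv)
    have "card (B \<inter> S) \<le> Suc 0" using xB[OF B(1) xin] by simp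
    then have "\<forall>a\<in>B \<inter> S. \<forall>b\<in>B \<inter> S. a = b" using card_le_Suc0_iff_eq[of "B \<inter> S"] finB by blast
    then have "B \<inter> S = {y}" using y KS(2) by blast
    then show ?thesis using xin y by blast
  qed
  have old: "B \<subseteq> S" "x \<notin> B" if "B \<in> P" "card (B \<inter> K) \<ge> 2" for B
    using R[rule_format, OF that] xS by blast+
  have SS': "insert x S \<subseteq> S'" unfolding S'_def cl_def by blast
  have R': "B \<subseteq> S' \<and> card (B \<inter> K') = 2 \<and> B \<inter> Z = {}" if B: "B \<in> P" "card (B \<inter> K') \<ge> 2" for B
  proof (cases "card (B \<inter> K) \<ge> 2")
    case True
    have "B \<inter> K' = B \<inter> K" using old[OF B(1) True] unfolding K'_def by blast
    then show ?thesis using R[rule_format, OF B(1) True] SS' by auto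
  next
    case False
    then obtain y where y: "x \<in> B" "y \<in> K" "B \<inter> S = {y}" using new[OF B False] by blast
    have "B \<inter> K' = {x, y}" using y KS(2) unfolding K'_def by blast
    moreover have "x \<noteq> y" using y xS by blast
    ultimately have c2: "card (B \<inter> K') = 2" by simp
    have "B \<inter> insert x S = {x, y}" using y by blast
    then have "card (B \<inter> insert x S) \<ge> 2" using \<open>x \<noteq> y\<close> by simp
    then have "B \<in> {B\<in>P. card (B \<inter> insert x S) \<ge> 2}" using B(1) by simp
    then have "B \<subseteq> S'" unfolding S'_def cl_def by (meson Union_upper le_supI2)
    moreover have "B \<inter> Z = {}"
    proof -
      have "B \<inter> Z \<subseteq> {y}" using y(3) KS(1) by blast
      moreover have "y \<notin> Z" using y(2) KS(4) by blast
      ultimately show ?thesis by blast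
    qed
    ultimately show ?thesis using c2 by simp
  qed
  \<comment> \<open>A block of the old kind lies in \<open>S\<close>, where one of the new kind has
    a single point, and that point is in \<open>K\<close>.\<close>
  have mixed: "B \<inter> B' \<subseteq> K'"
    if B: "B \<in> P" "card (B \<inter> K) \<ge> 2"
      and B': "B' \<in> P" "card (B' \<inter> K') \<ge> 2" "\<not> card (B' \<inter> K) \<ge> 2" for B B'
  proof -
    obtain y where y: "y \<in> K" "B' \<inter> S = {y}" using new[OF B'] by blast
    have "B \<inter> B' \<subseteq> B' \<inter> S" using old(1)[OF B] by blast
    also have "\<dots> \<subseteq> K'" using y unfolding K'_def by simp
    finally show ?thesis .
  qed
  have RR': "B \<inter> B' \<subseteq> K'"
    if B: "B \<in> P" "B' \<in> P" "card (B \<inter> K') \<ge> 2" "card (B' \<inter> K') \<ge> 2" "B \<noteq> B'" for B B'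
  proof (cases "card (B \<inter> K) \<ge> 2"; cases "card (B' \<inter> K) \<ge> 2")
    assume "card (B \<inter> K) \<ge> 2" "card (B' \<inter> K) \<ge> 2"
    then show ?thesis using RR B unfolding K'_def by blast
  next
    assume "card (B \<inter> K) \<ge> 2" "\<not> card (B' \<inter> K) \<ge> 2"
    then show ?thesis using mixed B by blast
  next
    assume "\<not> card (B \<inter> K) \<ge> 2" "card (B' \<inter> K) \<ge> 2"
    then show ?thesis using mixed[of B' B] B by blast
  next
    assume "\<not> card (B \<inter> K) \<ge> 2" "\<not> card (B' \<inter> K) \<ge> 2"
    then have "x \<in> B" "x \<in> B'" using new B by blast+
    then have "B \<inter> B' \<subseteq> {x}" using packing_block_eqI[OF P B(1,2), of x] B(5) by blast
    then show ?thesis unfolding K'_def by blast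
  qed
  have "Z \<subseteq> S'" "K' \<subseteq> S'" using SS' KS(1,2) unfolding K'_def by blast+
  moreover have "S' \<subseteq> {..<n}" unfolding S'_def using cl_sub[of "insert x S"] KS(3) x(1) by simp
  moreover have "K' \<inter> Z = {}" using KS(1,4) xS unfolding K'_def by blast
  moreover have "card K' = Suc j"
  proof -
    have "finite K" "x \<notin> K" using KS(2) finS xS finite_subset by blast+
    then show ?thesis using KS(5) unfolding K'_def by simp
  qed
  moreover have "\<forall>B\<in>P. card (B \<inter> K') \<ge> 2 \<longrightarrow> B \<subseteq> S' \<and> card (B \<inter> K') = 2 \<and> B \<inter> Z = {}"
    using R' by blast
  moreover have "\<forall>B\<in>P. \<forall>B'\<in>P. card (B \<inter> K') \<ge> 2 \<longrightarrow> card (B' \<inter> K') \<ge> 2 \<longrightarrow> B \<noteq> B' \<longrightarrow> B \<inter> B' \<subseteq> K'"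
    using RR' by blast
  ultimately show ?case using cS' by (intro exI[of _ K'] exI[of _ S'] conjI)
qed

section \<open>Switching blocks to make room for a new one\<close>

text \<open>Orient the edges of the complete graph on \<open>{0..k}\<close> upwards, except that \<open>{0, k}\<close> points to
  \<open>0\<close>. Every in-degree is then at most \<open>k - 1\<close>, so \<open>k - 1\<close> colours suffice to separate the edges
  with a common head.\<close>

lemma tournament_colouring:
  fixes k :: nat
  assumes "k \<ge> 2"
  shows "\<exists>tl hd col :: nat \<times> nat \<Rightarrow> nat.
    (\<forall>i j. i < j \<longrightarrow> j \<le> k \<longrightarrow> {tl (i, j), hd (i, j)} = {i, j} \<and> col (i, j) < k - 1) \<and>
    (\<forall>i j i' j'. i < j \<longrightarrow> j \<le> k \<longrightarrow> i' < j' \<longrightarrow> j' \<le> k \<longrightarrow> hd (i, j) = hd (i', j') \<longrightarrow>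
      col (i, j) = col (i', j') \<longrightarrow> (i, j) = (i', j'))"
proof -
  let ?tl = "\<lambda>(i, j). if i = 0 \<and> j = k then k else i"
  let ?hd = "\<lambda>(i, j). if i = 0 \<and> j = k then 0 else j"
  \<comment> \<open>The colour is the tail, lowered by one at head \<open>k\<close>, whose tails are
    \<open>1, ..., k - 1\<close> once the edge \<open>{0, k}\<close> is reversed. All colours are
    thus at most \<open>k - 2\<close>.\<close>
  let ?col = "\<lambda>(i, j). if i = 0 \<and> j = k then 0 else if j = k then i - 1 else i"
  show ?thesis
    using assms by (intro exI[of _ ?tl] exI[of _ ?hd] exI[of _ ?col]) auto
qed

text \<open>Each block holding a pair of \<open>K\<close> trades the tail of that pair for the point
  of \<open>Q\<close> given by its colour. It then meets \<open>K\<close> in the head only, so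
  \<open>K\<close> can join the packing; the colouring keeps altered blocks with a common head from
  receiving the same new point. \<open>Z\<close> contains the blocks that already meet
  \<open>Q\<close>, and the last conjunct locates such blocks afterwards, so that the step can be
  repeated.\<close>

lemma packing_switch:
  assumes P: "packing k n P" and k: "k \<ge> 2"
    and QZ: "Q \<subseteq> Z" "Z \<subseteq> {..<n}" "card Q = k - 1"
    and dirty: "\<forall>B\<in>P. B \<inter> Q \<noteq> {} \<longrightarrow> B \<subseteq> Z"
    and K: "K \<subseteq> {..<n}" "K \<inter> Z = {}" "card K = k + 1"
    and R2: "\<forall>B\<in>P. card (B \<inter> K) \<ge> 2 \<longrightarrow> card (B \<inter> K) = 2 \<and> B \<inter> Z = {}"
    and RK: "\<forall>B\<in>P. \<forall>B'\<in>P. card (B \<inter> K) \<ge> 2 \<longrightarrow> card (B' \<inter> K) \<ge> 2 \<longrightarrow> B \<noteq> B' \<longrightarrow> B \<inter> B' \<subseteq> K"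
  shows "\<exists>P'. packing k n P' \<and> card P' = card P + 1 \<and>
    (\<forall>B\<in>P'. B \<inter> Q \<noteq> {} \<longrightarrow> B \<subseteq> Z \<union> \<Union>{B\<in>P. card (B \<inter> K) \<ge> 2})"
proof -
  define R where "R = {B\<in>P. card (B \<inter> K) \<ge> 2}"
  have RP: "B \<in> P" if "B \<in> R" for B using that unfolding R_def by blast
  have "Q \<subseteq> {..<n}" using QZ by simp
  then have finK: "finite K" "finite Q"
    using K(1) finite_subset[OF _ finite_lessThan[of n]] by simp_all
  \<comment> \<open>\<open>e\<close> labels \<open>K\<close> by the vertices
    \<open>0, ..., k\<close> of the tournament, and \<open>q\<close> labels \<open>Q\<close> by its
    \<open>k - 1\<close> colours.\<close>
  obtain e where e: "bij_betw e {0..<k + 1} K" using ex_bij_betw_nat_finite[OF finK(1)] K(3) by auto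
  obtain q where q: "bij_betw q {0..<k - 1} Q" using ex_bij_betw_nat_finite[OF finK(2)] QZ(3) by auto
  obtain tl hd col :: "nat \<times> nat \<Rightarrow> nat" where
    pair: "\<forall>i j. i < j \<longrightarrow> j \<le> k \<longrightarrow> {tl (i, j), hd (i, j)} = {i, j} \<and> col (i, j) < k - 1"
    and col: "\<forall>i j i' j'. i < j \<longrightarrow> j \<le> k \<longrightarrow> i' < j' \<longrightarrow> j' \<le> k \<longrightarrow> hd (i, j) = hd (i', j') \<longrightarrow>
      col (i, j) = col (i', j') \<longrightarrow> (i, j) = (i', j')"
    using tournament_colouring[OF k] by (elim exE conjE)
  have "\<exists>p. fst p < snd p \<and> snd p \<le> k \<and> B \<inter> K = {e (fst p), e (snd p)}" if "B \<in> R" for B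
  proof -
    have "card (B \<inter> K) = 2" using R2 that unfolding R_def by blast
    then obtain x y where xy: "B \<inter> K = {x, y}" "x \<noteq> y" by (meson card_2_iff)
    then have "x \<in> K" "y \<in> K" by blast+
    then have "x \<in> e ` {0..<k + 1}" "y \<in> e ` {0..<k + 1}" using e unfolding bij_betw_def by simp_all
    then obtain i j where ij: "i < k + 1" "j < k + 1" "x = e i" "y = e j" by auto
    have "i \<noteq> j" using xy(2) ij(3,4) by auto
    then consider "i < j" | "j < i" by linarith
    then show ?thesis
    proof cases
      case 1
      then show ?thesis using ij xy by (intro exI[of _ "(i, j)"]) auto
    next
      case 2
      then show ?thesis using ij xy by (intro exI[of _ "(j, i)"]) auto
    qed
  qed
  then obtain p where p: "\<And>B. B \<in> R \<Longrightarrow> fst (p B) < snd (p B) \<and> snd (p B) \<le> k \<and> B \<inter> K = {e (fst (p B)), e (snd (p B))}"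
    by metis
  define t where "t = (\<lambda>B. e (tl (p B)))"
  define h where "h = (\<lambda>B. e (hd (p B)))"
  define c where "c = (\<lambda>B. q (col (p B)))"
  define \<phi> where "\<phi> = (\<lambda>B. insert (c B) (B - {t B}))"
  have th: "B \<inter> K = {t B, h B}" "hd (p B) < k + 1" "col (p B) < k - 1" if "B \<in> R" for B
  proof -
    obtain i j where ij: "p B = (i, j)" by fastforce
    have *: "i < j" "j \<le> k" "B \<inter> K = {e i, e j}" using p[OF that] ij by auto
    have **: "{tl (i, j), hd (i, j)} = {i, j}" "col (i, j) < k - 1" using pair * by blast+
    have "e ` {tl (i, j), hd (i, j)} = e ` {i, j}" using ** by simp
    then show "B \<inter> K = {t B, h B}" using * ij unfolding t_def h_def by simp
    have "hd (i, j) \<in> {i, j}" using ** by blast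
    then show "hd (p B) < k + 1" using * ij by auto
    show "col (p B) < k - 1" using ** ij by simp
  qed
  have cQ: "c B \<in> Q" if "B \<in> R" for B
    using th(3)[OF that] q unfolding c_def bij_betw_def by (meson atLeastLessThan_iff imageI zero_le subset_iff equalityD1)
  have BZ: "B \<inter> Z = {}" if "B \<in> R" for B using R2 that unfolding R_def by blast
  have cB: "c B \<notin> B'" if "B \<in> R" "B' \<in> R" for B B' using cQ[OF that(1)] BZ[OF that(2)] QZ(1) by blast
  have tB: "t B \<in> B" if "B \<in> R" for B using th(1)[OF that] by blast
  \<comment> \<open>A point that survives in both blocks lies in \<open>K\<close> by
    \<open>RK\<close>, so it is the head of both pairs. Equal colours would then give equal pairs,
    hence two common points.\<close>
  have key: "c B \<noteq> c B'" if B: "B \<in> R" "B' \<in> R" "B \<noteq> B'" and z: "z \<in> B - {t B}" "z \<in> B' - {t B'}" for B B' z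
  proof
    assume "c B = c B'"
    then have cc: "col (p B) = col (p B')"
      using q th(3)[OF B(1)] th(3)[OF B(2)] unfolding c_def bij_betw_def inj_on_def by simp
    have "z \<in> K" using RK B z unfolding R_def by blast
    then have "z = h B" "z = h B'" using th(1)[OF B(1)] th(1)[OF B(2)] z by blast+
    then have "hd (p B) = hd (p B')"
      using e th(2)[OF B(1)] th(2)[OF B(2)] unfolding h_def bij_betw_def inj_on_def by simp
    then have "p B = p B'" using cc col p[OF B(1)] p[OF B(2)] by (metis prod.collapse)
    then have "B \<inter> K = B' \<inter> K" using p[OF B(1)] p[OF B(2)] by simp
    then have "t B \<in> B \<inter> B'" "z \<in> B \<inter> B'" using z tB[OF B(1)] th(1)[OF B(1)] by blast+
    moreover have "t B \<noteq> z" using z by blast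
    ultimately show False using packing_block_eqI[OF P RP[OF B(1)] RP[OF B(2)]] B(3) by blast
  qed
  have finB: "finite B" if "B \<in> P" for B using packing_finite_block[OF P that] .
  have card_le_1: "card X \<le> 1" if "\<And>x y. x \<in> X \<Longrightarrow> y \<in> X \<Longrightarrow> x = y" for X :: "nat set"
  proof (cases "finite X")
    case True
    then show ?thesis using that card_le_Suc0_iff_eq[of X] by auto
  qed simp
  have card_\<phi>: "card (\<phi> B) = k + 1" if "B \<in> R" for B
  proof -
    have "card B = k + 1" using P RP[OF that] unfolding packing_def by blast
    then have "card (B - {t B}) = k" using tB[OF that] by simp
    moreover have "c B \<notin> B - {t B}" using cB[OF that that] by blast
    ultimately show ?thesis unfolding \<phi>_def using finB[OF RP[OF that]] by simp
  qed
  \<comment> \<open>A common point is either the new point of both or a survivor of both;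
    \<open>key\<close> excludes one of each.\<close>
  have \<phi>\<phi>: "card (\<phi> B \<inter> \<phi> B') \<le> 1" if B: "B \<in> R" "B' \<in> R" "B \<noteq> B'" for B B'
  proof (rule card_le_1, rule ccontr)
    fix x y assume xy: "x \<in> \<phi> B \<inter> \<phi> B'" "y \<in> \<phi> B \<inter> \<phi> B'" "x \<noteq> y"
    have split: "(z = c B \<and> z = c B') \<or> (z \<in> B - {t B} \<and> z \<in> B' - {t B'})" if "z \<in> \<phi> B \<inter> \<phi> B'" for z
      using that cB[OF B(1,2)] cB[OF B(2,1)] unfolding \<phi>_def by auto
    have "x \<in> B \<inter> B' \<and> y \<in> B \<inter> B'" using split[OF xy(1)] split[OF xy(2)] key[OF B] xy(3) by blast
    then show False using packing_block_eqI[OF P RP[OF B(1)] RP[OF B(2)]] B(3) xy(3) by blast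
  qed
  \<comment> \<open>An old block avoiding \<open>Q\<close> can share with \<open>\<phi> B\<close>
    only points of \<open>B\<close>; one that meets \<open>Q\<close> lies in \<open>Z\<close>, away
    from \<open>B\<close>, and can share only the new point.\<close>
  have old\<phi>: "card (C \<inter> \<phi> B) \<le> 1" if C: "C \<in> P - R" and B: "B \<in> R" for B C
  proof (rule card_le_1, rule ccontr)
    fix x y assume xy: "x \<in> C \<inter> \<phi> B" "y \<in> C \<inter> \<phi> B" "x \<noteq> y"
    show False
    proof (cases "C \<inter> Q = {}")
      case True
      then have "x \<in> C \<inter> B" "y \<in> C \<inter> B" using xy cQ[OF B] unfolding \<phi>_def by blast+
      then have "C = B" using packing_block_eqI[OF P _ RP[OF B]] C xy(3) by blast
      then show False using B C by blast
    next
      case False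
      then have "C \<subseteq> Z" using dirty C by blast
      then have "x = c B" "y = c B" using xy BZ[OF B] unfolding \<phi>_def by blast+
      then show False using xy by simp
    qed
  qed
  have oldK: "card (C \<inter> K) \<le> 1" if "C \<in> P - R" for C using that unfolding R_def by auto
  have \<phi>K: "card (\<phi> B \<inter> K) \<le> 1" if B: "B \<in> R" for B
  proof (rule card_le_1)
    fix x y assume xy: "x \<in> \<phi> B \<inter> K" "y \<in> \<phi> B \<inter> K"
    have "c B \<notin> K" using cQ[OF B] QZ(1) K(2) by blast
    then have "\<phi> B \<inter> K \<subseteq> {h B}" using th(1)[OF B] unfolding \<phi>_def by blast
    then show "x = y" using xy by blast
  qed
  define P' where "P' = insert K ((P - R) \<union> \<phi> ` R)"
  have card_P: "card C = k + 1" if "C \<in> P" for C using P that unfolding packing_def by blast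
  have finP: "finite P" "finite R" using packing_finite[OF P] unfolding R_def by auto
  have "inj_on \<phi> R"
  proof (rule inj_onI, rule ccontr)
    fix A B assume AB: "A \<in> R" "B \<in> R" "\<phi> A = \<phi> B" "A \<noteq> B"
    then show False using \<phi>\<phi>[OF AB(1,2,4)] card_\<phi>[OF AB(2)] k by simp
  qed
  then have cR: "card (\<phi> ` R) = card R" by (rule card_image)
  have "(P - R) \<inter> \<phi> ` R = {}"
  proof (rule ccontr)
    assume "(P - R) \<inter> \<phi> ` R \<noteq> {}"
    then obtain B where B: "B \<in> R" "\<phi> B \<in> P - R" by blast
    then show False using old\<phi>[OF B(2,1)] card_\<phi>[OF B(1)] k by simp
  qed
  then have "card ((P - R) \<union> \<phi> ` R) = card (P - R) + card R"
    using finP cR by (subst card_Un_disjoint) auto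
  also have "\<dots> = card P"
  proof -
    have "R \<subseteq> P" using RP by blast
    then show ?thesis using finP by (simp add: card_Diff_subset card_mono)
  qed
  finally have c0: "card ((P - R) \<union> \<phi> ` R) = card P" .
  have "K \<notin> (P - R) \<union> \<phi> ` R"
  proof
    assume "K \<in> (P - R) \<union> \<phi> ` R"
    then consider "K \<in> P - R" | B where "B \<in> R" "K = \<phi> B" by blast
    then show False
    proof cases
      case 1
      then show False using oldK[OF 1] K(3) k by simp
    next
      case 2
      then show False using \<phi>K[OF 2(1)] K(3) k by simp
    qed
  qed
  then have cP': "card P' = card P + 1" unfolding P'_def using c0 finP by simp
  have "packing k n P'"
    unfolding packing_def
  proof (intro conjI ballI impI)
    show "P' \<subseteq> Pow {..<n}"
    proof -
      have PP: "P \<subseteq> Pow {..<n}" using P unfolding packing_def by blast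
      have "\<phi> B \<subseteq> {..<n}" if "B \<in> R" for B
      proof -
        have "B \<subseteq> {..<n}" using PP RP[OF that] by blast
        moreover have "c B \<in> {..<n}" using cQ[OF that] QZ by blast
        ultimately show ?thesis unfolding \<phi>_def by blast
      qed
      then show ?thesis using PP K(1) unfolding P'_def by blast
    qed
    show "card B = k + 1" if "B \<in> P'" for B
      using that K(3) card_\<phi> card_P unfolding P'_def by blast
    show "card (B \<inter> B') \<le> 1" if BB: "B \<in> P'" "B' \<in> P'" "B \<noteq> B'" for B B'
    proof -
      have com: "card (X \<inter> Y) \<le> 1 \<Longrightarrow> card (Y \<inter> X) \<le> 1" for X Y :: "nat set" by (simp add: Int_commute)
      have PP: "card (X \<inter> Y) \<le> 1" if "X \<in> P - R" "Y \<in> P - R" "X \<noteq> Y" for X Y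
        using that P unfolding packing_def by blast
      consider "B = K" | "B \<in> P - R" | A where "A \<in> R" "B = \<phi> A" using BB(1) unfolding P'_def by blast
      then show ?thesis
      proof cases
        case 1
        then consider "B' \<in> P - R" | A where "A \<in> R" "B' = \<phi> A" using BB unfolding P'_def by blast
        then show ?thesis using 1 oldK \<phi>K com by cases blast+
      next
        case 2
        then consider "B' = K" | "B' \<in> P - R" | A where "A \<in> R" "B' = \<phi> A" using BB(2) unfolding P'_def by blast
        then show ?thesis using 2 oldK PP[OF 2 _ BB(3)] old\<phi>[OF 2] by cases blast+
      next
        case (3 A)
        consider "B' = K" | "B' \<in> P - R" | A' where "A' \<in> R" "B' = \<phi> A'" using BB(2) unfolding P'_def by blast
        then show ?thesis
        proof cases
          case 1
          then show ?thesis using \<phi>K 3 by blast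
        next
          case 2
          then show ?thesis using old\<phi>[OF 2 3(1)] 3(2) com by blast
        next
          case (3 A')
          then show ?thesis using \<phi>\<phi>[of A A'] \<open>A \<in> R\<close> \<open>B = \<phi> A\<close> BB(3) by blast
        qed
      qed
    qed
  qed
  moreover have "B \<subseteq> Z \<union> \<Union>R" if B: "B \<in> P'" "B \<inter> Q \<noteq> {}" for B
  proof -
    consider "B = K" | "B \<in> P - R" | A where "A \<in> R" "B = \<phi> A" using B(1) unfolding P'_def by blast
    then show ?thesis
    proof cases
      case 1
      then show ?thesis using B(2) K(2) QZ(1) by blast
    next
      case 2
      then show ?thesis using B(2) dirty by blast
    next
      case (3 A)
      then show ?thesis using cQ[OF 3(1)] QZ(1) unfolding \<phi>_def by blast
    qed
  qed
  ultimately show ?thesis using cP' unfolding R_def by (intro exI[of _ P']) blast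
qed

text \<open>A generic \<open>K\<close> is switched in. The altered blocks and \<open>Z\<close> lie
  in the set \<open>S\<close> of the greedy construction, which has bounded size and serves as
  \<open>Z\<close> in the next round.\<close>

lemma packing_gain_one:
  assumes P: "packing k n P" and k: "k \<ge> 2"
    and Q: "Q \<subseteq> Z" "Z \<subseteq> {..<n}" "card Q = k - 1" "card Z \<le> D"
    and dirty: "\<forall>B\<in>P. B \<inter> Q \<noteq> {} \<longrightarrow> B \<subseteq> Z"
    and n: "growth k D (k + 1) < n"
  shows "\<exists>P' Z'. packing k n P' \<and> card P' = card P + 1 \<and> Q \<subseteq> Z' \<and> Z' \<subseteq> {..<n} \<and>
    card Z' \<le> growth k D (k + 1) \<and> (\<forall>B\<in>P'. B \<inter> Q \<noteq> {} \<longrightarrow> B \<subseteq> Z')"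
proof -
  from packing_generic_block[OF P Q(2,4) n] obtain K S where
    KS: "Z \<subseteq> S" "K \<subseteq> S" "S \<subseteq> {..<n}" "K \<inter> Z = {}" "card K = k + 1" "card S \<le> growth k D (k + 1)"
    and R: "\<forall>B\<in>P. card (B \<inter> K) \<ge> 2 \<longrightarrow> B \<subseteq> S \<and> card (B \<inter> K) = 2 \<and> B \<inter> Z = {}"
    and RK: "\<forall>B\<in>P. \<forall>B'\<in>P. card (B \<inter> K) \<ge> 2 \<longrightarrow> card (B' \<inter> K) \<ge> 2 \<longrightarrow> B \<noteq> B' \<longrightarrow> B \<inter> B' \<subseteq> K"
    by (elim exE conjE)
  have R2: "\<forall>B\<in>P. card (B \<inter> K) \<ge> 2 \<longrightarrow> card (B \<inter> K) = 2 \<and> B \<inter> Z = {}" using R by blast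
  have "K \<subseteq> {..<n}" using KS(2,3) by blast
  from packing_switch[OF P k Q(1-3) dirty this KS(4,5) R2 RK] obtain P' where
    P': "packing k n P'" "card P' = card P + 1"
    and d': "\<forall>B\<in>P'. B \<inter> Q \<noteq> {} \<longrightarrow> B \<subseteq> Z \<union> \<Union>{B\<in>P. card (B \<inter> K) \<ge> 2}"
    by (elim exE conjE)
  have "Z \<union> \<Union>{B\<in>P. card (B \<inter> K) \<ge> 2} \<subseteq> S" using KS(1) R by blast
  then have "\<forall>B\<in>P'. B \<inter> Q \<noteq> {} \<longrightarrow> B \<subseteq> S" using d' by blast
  moreover have "Q \<subseteq> S" using Q(1) KS(1) by blast
  ultimately show ?thesis using P' KS(3,6) by (intro exI[of _ P'] exI[of _ S] conjI)
qed

text \<open>The first round starts with \<open>Z = Q\<close>, as no block meets \<open>Q\<close>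
  yet; the second with a set of size at most \<open>growth k k (k + 1)\<close>, whence the nested
  bound. Two new blocks are wanted because one would only make up for the loss of the word
  \<open>Q\<close>.\<close>

lemma packing_gain_two:
  assumes P: "packing k n P" and k: "k \<ge> 2"
    and Q: "Q \<subseteq> {..<n}" "card Q = k - 1" "\<forall>B\<in>P. B \<inter> Q = {}"
    and n: "growth k (growth k k (k + 1)) (k + 1) < n" "growth k k (k + 1) < n"
  shows "\<exists>P'. packing k n P' \<and> card P' = card P + 2"
proof -
  have "\<forall>B\<in>P. B \<inter> Q \<noteq> {} \<longrightarrow> B \<subseteq> Q" using Q(3) by blast
  moreover have "card Q \<le> k" using Q(2) by simp
  ultimately obtain P1 Z1 where 1: "packing k n P1" "card P1 = card P + 1" "Q \<subseteq> Z1" "Z1 \<subseteq> {..<n}"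
    "card Z1 \<le> growth k k (k + 1)" "\<forall>B\<in>P1. B \<inter> Q \<noteq> {} \<longrightarrow> B \<subseteq> Z1"
    using packing_gain_one[OF P k order.refl Q(1,2) _ _ n(2)] by blast
  then obtain P2 where "packing k n P2" "card P2 = card P1 + 1"
    using packing_gain_one[OF 1(1) k 1(3,4) Q(2) 1(5,6) n(1)] by blast
  then show ?thesis using 1(2) by auto
qed

section \<open>Structure of large families with two distances\<close>

text \<open>Codes as families of supports, with \<open>d = 2 * k\<close>. The distances are allowed
  rather than attained; attainment is dealt with when packings are turned into codes.\<close>

definition two_distance :: "nat \<Rightarrow> nat \<Rightarrow> nat set set \<Rightarrow> bool" where
  "two_distance k n F \<longleftrightarrow> F \<subseteq> Pow {..<n} \<and>
     (\<forall>X\<in>F. \<forall>X'\<in>F. X \<noteq> X' \<longrightarrow> card (sym_diff X X') \<in> {2 * k, 2 * k + 2})"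

lemma two_distance_finite: "two_distance k n F \<Longrightarrow> finite F"
  unfolding two_distance_def by (meson finite_Pow_iff finite_lessThan finite_subset)

lemma two_distance_finite_word: "two_distance k n F \<Longrightarrow> X \<in> F \<Longrightarrow> finite X"
  unfolding two_distance_def by (meson PowD finite_lessThan finite_subset subsetD)

text \<open>Pigeonhole over the two nonzero weights, then over the
  \<open>2 ^ w \<le> 2 ^ (2 * k + 2)\<close> traces on a word \<open>a\<close> of weight
  \<open>w\<close>. The distance to \<open>a\<close> fixes the trace size as \<open>w - k\<close> or
  \<open>w - k - 1\<close>; the first leaves at most \<open>n\<close> words, so in a large class the
  second holds, and translating by the trace gives weight \<open>k + 1\<close>.\<close>

lemma two_distance_core:
  assumes F: "two_distance k n F" and k: "k \<ge> 1" and empty: "{} \<in> F" and c: "c \<ge> 1"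
    and big: "card F > 2 * (2 ^ (2 * k + 2) * (c * n)) + 1"
  shows "\<exists>Y. Y \<subseteq> {..<n} \<and> card Y \<le> 2 * k + 2 \<and> card {X\<in>F. card (sym_diff X Y) = k + 1} > c * n"
proof -
  have dist: "card (sym_diff X X') = 2 * k \<or> card (sym_diff X X') = 2 * k + 2"
    if "X \<in> F" "X' \<in> F" "X \<noteq> X'" for X X'
    using F that unfolding two_distance_def by blast
  have finF: "finite F" using two_distance_finite[OF F] .
  have finX: "finite X" if "X \<in> F" for X using two_distance_finite_word[OF F that] .
  define W where "W = (\<lambda>w. {X\<in>F. card X = w})"
  have "F \<subseteq> insert {} (W (2 * k) \<union> W (2 * k + 2))"
    using dist[OF _ empty] unfolding W_def by auto
  then have "card F \<le> card (insert {} (W (2 * k) \<union> W (2 * k + 2)))"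
    using finF by (intro card_mono) (auto simp: W_def)
  also have "\<dots> \<le> Suc (card (W (2 * k) \<union> W (2 * k + 2)))"
    using finF by (intro card_insert_le_m1) (auto simp: W_def)
  also have "\<dots> \<le> Suc (card (W (2 * k)) + card (W (2 * k + 2)))" using card_Un_le by simp
  finally have sum: "card F \<le> Suc (card (W (2 * k)) + card (W (2 * k + 2)))" .
  obtain w where w: "w = 2 * k \<or> w = 2 * k + 2" "card (W w) > 2 ^ (2 * k + 2) * (c * n)"
  proof (cases "card (W (2 * k)) > 2 ^ (2 * k + 2) * (c * n)")
    case True
    then show ?thesis using that by blast
  next
    case False
    then have "card (W (2 * k + 2)) > 2 ^ (2 * k + 2) * (c * n)" using sum big by linarith
    then show ?thesis using that by blast
  qed
  then have "W w \<noteq> {}" by auto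
  then obtain a where a: "a \<in> F" "card a = w" unfolding W_def by blast
  have "a \<noteq> {}" using a w k by auto
  then obtain z where "z \<in> a" by blast
  moreover have an: "a \<subseteq> {..<n}" using F a(1) unfolding two_distance_def by blast
  ultimately have "z < n" by blast
  then have n: "n \<ge> 1" by linarith
  define cls where "cls = (\<lambda>T. {X \<in> W w. X \<inter> a = T})"
  have "\<exists>T\<in>Pow a. card (cls T) > c * n"
  proof (rule ccontr)
    assume neg: "\<not> ?thesis"
    have "W w \<subseteq> (\<Union>T\<in>Pow a. cls T)"
    proof
      fix X assume "X \<in> W w"
      then have "X \<in> cls (X \<inter> a)" unfolding cls_def by simp
      then show "X \<in> (\<Union>T\<in>Pow a. cls T)" by (intro UN_I[of "X \<inter> a"]) simp_all
    qed
    moreover have "finite (\<Union>T\<in>Pow a. cls T)"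
      using finF finX[OF a(1)] unfolding cls_def W_def by simp
    ultimately have "card (W w) \<le> card (\<Union>T\<in>Pow a. cls T)" by (intro card_mono)
    also have "\<dots> \<le> (\<Sum>T\<in>Pow a. card (cls T))"
      by (rule card_UN_le) (simp add: finX[OF a(1)])
    also have "\<dots> \<le> (\<Sum>T\<in>Pow a. c * n)"
    proof (rule sum_mono)
      fix T assume "T \<in> Pow a"
      then have "\<not> card (cls T) > c * n" using neg by blast
      then show "card (cls T) \<le> c * n" by linarith
    qed
    also have "\<dots> = 2 ^ w * (c * n)" using card_Pow[OF finX[OF a(1)]] a(2) by simp
    also have "\<dots> \<le> 2 ^ (2 * k + 2) * (c * n)"
      by (intro mult_right_mono power_increasing) (use w in auto)
    finally show False using w(2) by simp
  qed
  then obtain T where T: "T \<subseteq> a" "card (cls T) > c * n" by blast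
  have cls: "X \<in> F" "card X = w" "T \<subseteq> X" "X \<inter> a = T" if "X \<in> cls T" for X
    using that unfolding cls_def W_def by auto
  have finT: "finite T" using T(1) finX[OF a(1)] finite_subset by blast
  have cn: "c * n \<ge> n" "c * n \<ge> 1" using c n by simp_all
  have "\<not> cls T \<subseteq> {a}"
  proof
    assume "cls T \<subseteq> {a}"
    then have "card (cls T) \<le> card {a}" by (intro card_mono) auto
    then show False using T(2) cn(2) by simp
  qed
  then obtain X where X: "X \<in> cls T" "X \<noteq> a" by blast
  have "card (sym_diff X a) + 2 * card T = 2 * w"
    using card_sym_diff_plus[OF finX[OF cls(1)[OF X(1)]] finX[OF a(1)]] cls[OF X(1)] a(2) by simp
  moreover have "card (sym_diff X a) = 2 * k \<or> card (sym_diff X a) = 2 * k + 2"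
    using dist[OF cls(1)[OF X(1)] a(1) X(2)] .
  ultimately consider "w = card T + k" | "w = card T + k + 1" by linarith
  then have wT: "w = card T + k + 1"
  proof cases
    case 1
    \<comment> \<open>Here \<open>card T = w - k\<close> is the largest intersection that distance
      \<open>2 * k\<close> permits, so two words of the class meet exactly in
      \<open>T\<close>.\<close>
    have "inj_on (\<lambda>X. X - T) (cls T)" by (rule inj_onI) (use cls(3) in blast)
    then have "card (cls T) = card ((\<lambda>X. X - T) ` cls T)" by (simp add: card_image)
    also have "\<dots> \<le> n"
    proof (rule card_pairwise_disjoint_le)
      show "(\<lambda>X. X - T) ` cls T \<subseteq> Pow {..<n}" using cls(1) F unfolding two_distance_def by blast
      show "{} \<notin> (\<lambda>X. X - T) ` cls T"
      proof
        assume "{} \<in> (\<lambda>X. X - T) ` cls T"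
        then obtain X where X: "X \<in> cls T" "X \<subseteq> T" by blast
        then have "card X \<le> card T" using finT card_mono by blast
        then show False using cls(2)[OF X(1)] 1 k by simp
      qed
      fix A B assume A: "A \<in> (\<lambda>X. X - T) ` cls T" and B: "B \<in> (\<lambda>X. X - T) ` cls T" and ne: "A \<noteq> B"
      obtain X where X: "X \<in> cls T" "A = X - T" using A by blast
      obtain X' where X': "X' \<in> cls T" "B = X' - T" using B by blast
      have "X \<noteq> X'" using X X' ne by blast
      then have "card (sym_diff X X') \<ge> 2 * k"
        using dist[OF cls(1)[OF X(1)] cls(1)[OF X'(1)]] by linarith
      moreover have "card (sym_diff X X') + 2 * card (X \<inter> X') = 2 * w"
        using card_sym_diff_plus[OF finX[OF cls(1)[OF X(1)]] finX[OF cls(1)[OF X'(1)]]]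
          cls(2)[OF X(1)] cls(2)[OF X'(1)] by simp
      ultimately have "card (X \<inter> X') \<le> card T" using 1 by linarith
      moreover have "T \<subseteq> X \<inter> X'" using cls(3)[OF X(1)] cls(3)[OF X'(1)] by blast
      moreover have "finite (X \<inter> X')" using finX[OF cls(1)[OF X(1)]] by simp
      ultimately have "T = X \<inter> X'" by (intro card_seteq)
      then show "A \<inter> B = {}" using X X' by blast
    qed
    finally show ?thesis using T(2) cn(1) by linarith
  qed
  have "cls T \<subseteq> {X\<in>F. card (sym_diff X T) = k + 1}"
  proof
    fix X assume X: "X \<in> cls T"
    have "sym_diff X T = X - T" using cls(3)[OF X] by blast
    moreover have "card (X - T) = card X - card T" using card_Diff_subset[OF finT cls(3)[OF X]] .
    ultimately show "X \<in> {X\<in>F. card (sym_diff X T) = k + 1}" using cls(1,2)[OF X] wT by simp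
  qed
  then have "card (cls T) \<le> card {X\<in>F. card (sym_diff X T) = k + 1}"
    using finF by (intro card_mono) auto
  moreover have "card T \<le> 2 * k + 2" using wT w(1) by linarith
  ultimately show ?thesis using T an by (intro exI[of _ T]) auto
qed

lemma sym_diff_cancel_right: "sym_diff (sym_diff X Y) (sym_diff X' Y) = sym_diff X X'"
  by blast

lemma two_distance_translate:
  assumes F: "two_distance k n F" and Y: "Y \<subseteq> {..<n}"
  shows "two_distance k n ((\<lambda>X. sym_diff X Y) ` F)" "inj_on (\<lambda>X. sym_diff X Y) F"
proof -
  show "inj_on (\<lambda>X. sym_diff X Y) F" by (rule inj_onI) blast
  have "(\<lambda>X. sym_diff X Y) ` F \<subseteq> Pow {..<n}" using F Y unfolding two_distance_def by blast
  moreover have "card (sym_diff A B) \<in> {2 * k, 2 * k + 2}"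
    if A: "A \<in> (\<lambda>X. sym_diff X Y) ` F" and B: "B \<in> (\<lambda>X. sym_diff X Y) ` F" and ne: "A \<noteq> B" for A B
  proof -
    obtain X where X: "X \<in> F" "A = sym_diff X Y" using A by blast
    obtain X' where X': "X' \<in> F" "B = sym_diff X' Y" using B by blast
    have "X \<noteq> X'" using X X' ne by blast
    then show ?thesis using F X X' sym_diff_cancel_right[of X Y X'] unfolding two_distance_def by simp
  qed
  ultimately show "two_distance k n ((\<lambda>X. sym_diff X Y) ` F)" unfolding two_distance_def by blast
qed

lemma two_distance_packing:
  assumes "two_distance k n F"
  shows "packing k n {X\<in>F. card X = k + 1}"
  unfolding packing_def
proof (intro conjI ballI impI)
  show "{X\<in>F. card X = k + 1} \<subseteq> Pow {..<n}" using assms unfolding two_distance_def by blast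
  fix X X' assume X: "X \<in> {X\<in>F. card X = k + 1}"
  show "card X = k + 1" using X by simp
  assume X': "X' \<in> {X\<in>F. card X = k + 1}" and ne: "X \<noteq> X'"
  have "card (sym_diff X X') \<ge> 2 * k" using assms X X' ne unfolding two_distance_def by force
  moreover have "card (sym_diff X X') + 2 * card (X \<inter> X') = card X + card X'"
    by (rule card_sym_diff_plus) (use X X' two_distance_finite_word[OF assms] in auto)
  ultimately show "card (X \<inter> X') \<le> 1" using X X' by simp
qed

text \<open>Some block misses the bounded word \<open>X\<close>, so their distance is
  \<open>card X + k + 1\<close>; equating this with \<open>2 * k\<close> or \<open>2 * k + 2\<close>
  leaves the two weights.\<close>

lemma two_distance_weights:
  assumes F: "two_distance k n F" and k: "k \<ge> 1" and X: "X \<in> F" "card X \<le> c"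
    and big: "card {X\<in>F. card X = k + 1} > c * n"
  shows "card X = k - 1 \<or> card X = k + 1"
proof (rule ccontr)
  assume neg: "\<not> ?thesis"
  have finX: "finite X" using two_distance_finite_word[OF F X(1)] .
  have "card X * n \<le> c * n" using X(2) by simp
  then have "card {X\<in>F. card X = k + 1} > card X * n" using big by linarith
  from packing_disjoint_block[OF two_distance_packing[OF F] k finX this]
  obtain B where B: "B \<in> F" "card B = k + 1" "B \<inter> X = {}" by blast
  have "B \<noteq> X" using B(2) neg by blast
  then have "card (sym_diff B X) = 2 * k \<or> card (sym_diff B X) = 2 * k + 2"
    using F B(1) X(1) unfolding two_distance_def by blast
  moreover have "card (sym_diff B X) = card B + card X"
    using card_sym_diff_plus[OF two_distance_finite_word[OF F B(1)] finX] B(3) by simp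
  ultimately show False using B(2) neg k by auto
qed

text \<open>A word of weight \<open>k - 1\<close> is unique and avoids all blocks, so its \<open>k - 1\<close> points are available
  for the switching argument, which gains one block more than this word was worth.\<close>

lemma two_distance_constant_weight:
  assumes F: "two_distance k n F" and k: "k \<ge> 2"
    and weights: "\<forall>X\<in>F. card X = k - 1 \<or> card X = k + 1"
    and n: "growth k (growth k k (k + 1)) (k + 1) < n" "growth k k (k + 1) < n"
    and opt: "\<forall>P. packing k n P \<longrightarrow> card P \<le> card F"
  shows "\<forall>X\<in>F. card X = k + 1"
proof (rule ccontr)
  assume "\<not> ?thesis"
  then obtain Q where Q: "Q \<in> F" "card Q = k - 1" using weights by blast
  have finQ: "finite Q" using two_distance_finite_word[OF F Q(1)] .
  have dist: "card (sym_diff X Q) \<ge> 2 * k" if "X \<in> F" "X \<noteq> Q" for X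
    using F that Q(1) unfolding two_distance_def by force
  have sd: "card (sym_diff X Q) + 2 * card (X \<inter> Q) = card X + (k - 1)" if "X \<in> F" for X
    using card_sym_diff_plus[OF two_distance_finite_word[OF F that] finQ] Q(2) by simp
  define P where "P = {X\<in>F. card X = k + 1}"
  have P: "packing k n P" unfolding P_def by (rule two_distance_packing[OF F])
  \<comment> \<open>Two words of weight \<open>k - 1\<close> are at distance at most
    \<open>2 * k - 2\<close>, so \<open>Q\<close> is the only one.\<close>
  have "X = Q \<or> card X = k + 1" if "X \<in> F" for X
  proof (rule ccontr)
    assume neg: "\<not> ?thesis"
    then have "card X = k - 1" using weights that by blast
    then show False using dist[OF that] sd[OF that] neg k by simp
  qed
  then have "F = insert Q P" using Q(1) unfolding P_def by blast
  moreover have "Q \<notin> P" using Q(2) unfolding P_def by auto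
  ultimately have cF: "card F = card P + 1" using packing_finite[OF P] by simp
  \<comment> \<open>\<open>(k + 1) + (k - 1)\<close> is exactly \<open>2 * k\<close>, so the smaller
    distance already leaves no common point.\<close>
  have PQ: "\<forall>B\<in>P. B \<inter> Q = {}"
  proof
    fix B assume "B \<in> P"
    then have B: "B \<in> F" "card B = k + 1" "B \<noteq> Q" using Q(2) unfolding P_def by auto
    then have "card (B \<inter> Q) = 0" using dist[OF B(1,3)] sd[OF B(1)] k by simp
    then show "B \<inter> Q = {}" using finQ by simp
  qed
  have "Q \<subseteq> {..<n}" using F Q(1) unfolding two_distance_def by blast
  from packing_gain_two[OF P k this Q(2) PQ n] obtain P' where "packing k n P'" "card P' = card P + 2"
    by blast
  then show False using opt cF by fastforce
qed

text \<open>Translation by a word \<open>X0\<close> brings in the empty set, translation by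
  \<open>Y\<close> exposes a large packing, and the witness is the sum of the two.\<close>

lemma two_distance_optimal:
  assumes F: "two_distance k n F" and k: "k \<ge> 2"
    and n: "growth k (growth k k (k + 1)) (k + 1) < n" "growth k k (k + 1) < n"
    and big: "card F > 2 * (2 ^ (2 * k + 2) * ((4 * k + 4) * n)) + 1"
    and opt: "\<forall>P. packing k n P \<longrightarrow> card P \<le> card F"
  shows "\<exists>Y\<subseteq>{..<n}. \<forall>X\<in>F. card (sym_diff X Y) = k + 1"
proof -
  have "F \<noteq> {}" using big by auto
  then obtain X0 where X0: "X0 \<in> F" by blast
  then have X0n: "X0 \<subseteq> {..<n}" using F unfolding two_distance_def by blast
  define F1 where "F1 = (\<lambda>X. sym_diff X X0) ` F"
  have F1: "two_distance k n F1" unfolding F1_def by (rule two_distance_translate[OF F X0n])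
  have card1: "card F1 = card F" unfolding F1_def by (rule card_image[OF two_distance_translate(2)[OF F X0n]])
  have "sym_diff X0 X0 \<in> F1" unfolding F1_def using X0 by (rule imageI)
  then have empty: "{} \<in> F1" by simp
  \<comment> \<open>\<open>4 * k + 4\<close> bounds the weights after the second translation:
    \<open>2 * k + 2\<close> from the word and as much from \<open>Y\<close>.\<close>
  have "k \<ge> 1" "4 * k + 4 \<ge> 1" using k by simp_all
  from two_distance_core[OF F1 this(1) empty this(2)] obtain Y where
    Y: "Y \<subseteq> {..<n}" "card Y \<le> 2 * k + 2"
      "card {X\<in>F1. card (sym_diff X Y) = k + 1} > (4 * k + 4) * n"
    using big card1 by auto
  define F2 where "F2 = (\<lambda>X. sym_diff X Y) ` F1"
  have F2: "two_distance k n F2" unfolding F2_def by (rule two_distance_translate[OF F1 Y(1)])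
  have inj: "inj_on (\<lambda>X. sym_diff X Y) F1" by (rule two_distance_translate(2)[OF F1 Y(1)])
  have card2: "card F2 = card F" unfolding F2_def using card_image[OF inj] card1 by simp
  have "{X\<in>F2. card X = k + 1} = (\<lambda>X. sym_diff X Y) ` {X\<in>F1. card (sym_diff X Y) = k + 1}"
    unfolding F2_def by auto
  moreover have "inj_on (\<lambda>X. sym_diff X Y) {X\<in>F1. card (sym_diff X Y) = k + 1}"
    by (rule inj_on_subset[OF inj]) blast
  ultimately have big2: "card {X\<in>F2. card X = k + 1} > (4 * k + 4) * n"
    using Y(3) by (simp add: card_image)
  have "card X = k - 1 \<or> card X = k + 1" if X: "X \<in> F2" for X
  proof (rule two_distance_weights[OF F2 \<open>k \<ge> 1\<close> X _ big2])
    obtain X1 where X1: "X1 \<in> F1" "X = sym_diff X1 Y" using X unfolding F2_def by blast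
    have "card X1 \<le> 2 * k + 2"
    proof (cases "X1 = {}")
      case False
      then have "card (sym_diff X1 {}) \<in> {2 * k, 2 * k + 2}"
        using F1 X1(1) empty unfolding two_distance_def by blast
      then show ?thesis by auto
    qed simp
    moreover have "card X + 2 * card (X1 \<inter> Y) = card X1 + card Y" unfolding X1(2)
      by (rule card_sym_diff_plus[OF two_distance_finite_word[OF F1 X1(1)] finite_subset[OF Y(1) finite_lessThan]])
    ultimately show "card X \<le> 4 * k + 4" using Y(2) by linarith
  qed
  then have "\<forall>X\<in>F2. card X = k - 1 \<or> card X = k + 1" by blast
  moreover have "\<forall>P. packing k n P \<longrightarrow> card P \<le> card F2" using opt card2 by simp
  ultimately have all: "\<forall>X\<in>F2. card X = k + 1" using two_distance_constant_weight[OF F2 k _ n] by blast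
  have F2w: "card (sym_diff (sym_diff X X0) Y) = k + 1" if "X \<in> F" for X
  proof -
    have "sym_diff (sym_diff X X0) Y \<in> F2" unfolding F2_def F1_def using that by (intro imageI)
    then show ?thesis using all by blast
  qed
  show ?thesis
  proof (intro exI[of _ "sym_diff X0 Y"] conjI ballI)
    show "sym_diff X0 Y \<subseteq> {..<n}" using X0n Y(1) by blast
    fix X assume X: "X \<in> F"
    have "sym_diff X (sym_diff X0 Y) = sym_diff (sym_diff X X0) Y" by blast
    then show "card (sym_diff X (sym_diff X0 Y)) = k + 1" using F2w[OF X] by simp
  qed
qed

section \<open>Binary vectors and their supports\<close>

definition supp :: "bit vec \<Rightarrow> nat set" where
  "supp v = {i. i < dim_vec v \<and> v $ i \<noteq> 0}"

definition indicator_vec :: "nat \<Rightarrow> nat set \<Rightarrow> bit vec" where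
  "indicator_vec n S = vec n (\<lambda>i. if i \<in> S then 1 else 0)"

lemma indicator_vec_carrier: "indicator_vec n S \<in> carrier_vec n"
  unfolding indicator_vec_def by simp

lemma supp_indicator_vec: "S \<subseteq> {..<n} \<Longrightarrow> supp (indicator_vec n S) = S"
  unfolding indicator_vec_def supp_def by (auto split: if_splits)

lemma supp_subset: "v \<in> carrier_vec n \<Longrightarrow> supp v \<subseteq> {..<n}"
  unfolding supp_def by auto

lemma supp_inj: "inj_on supp (carrier_vec n)"
proof (rule inj_onI)
  fix u v assume uv: "u \<in> carrier_vec n" "v \<in> carrier_vec n" "supp u = supp v"
  show "u = v"
  proof (rule eq_vecI)
    fix i assume "i < dim_vec v"
    then have "i \<in> supp u \<longleftrightarrow> u $ i \<noteq> 0" "i \<in> supp v \<longleftrightarrow> v $ i \<noteq> 0"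
      using uv(1,2) unfolding supp_def by auto
    then show "u $ i = v $ i" using uv(3) by (metis bit_not_zero_iff)
  qed (use uv in auto)
qed

lemma hamming_weight_supp: "hamming_weight v = card (supp v)"
  unfolding hamming_weight_def supp_def ..

lemma hamming_dist_supp:
  assumes "u \<in> carrier_vec n" "v \<in> carrier_vec n"
  shows "hamming_dist u v = card (sym_diff (supp u) (supp v))"
proof -
  have "a \<noteq> b \<longleftrightarrow> (a \<noteq> 0) \<noteq> (b \<noteq> 0)" for a b :: bit by (metis bit_not_zero_iff)
  then have "{i. i < dim_vec u \<and> u $ i \<noteq> v $ i} = sym_diff (supp u) (supp v)"
    using assms unfolding supp_def by auto
  then show ?thesis unfolding hamming_dist_def by simp
qed

lemma supp_add:
  assumes "u \<in> carrier_vec n" "v \<in> carrier_vec n"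
  shows "supp (u + v) = sym_diff (supp u) (supp v)"
proof -
  have "a + b \<noteq> 0 \<longleftrightarrow> (a \<noteq> 0) \<noteq> (b \<noteq> 0)" for a b :: bit by (cases a; cases b) auto
  then show ?thesis using assms unfolding supp_def by auto
qed

text \<open>Supports embed a code in a power set of size \<open>2 ^ n\<close>, so the set of sizes
  is finite and its \<open>Max\<close> is an upper bound.\<close>

lemma binary_code_le_A2:
  assumes "binary_code n M D C"
  shows "M \<le> A2 n D"
proof -
  have "M' \<le> 2 ^ n" if "binary_code n M' D C'" for M' C'
  proof -
    have C': "C' \<subseteq> carrier_vec n" "card C' = M'" using that unfolding binary_code_def by auto
    have "supp ` C' \<subseteq> Pow {..<n}" using C'(1) supp_subset by blast
    then have "card C' \<le> card (Pow {..<n})"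
      by (intro card_inj_on_le[OF inj_on_subset[OF supp_inj C'(1)]]) auto
    then show ?thesis using C'(2) by (simp add: card_Pow)
  qed
  then have "finite {M. \<exists>C. binary_code n M D C}"
    by (intro finite_subset[OF _ finite_atMost[of "2 ^ n"]]) auto
  then show ?thesis unfolding A2_def using assms by (intro Max_ge) auto
qed

lemma binary_code_two_distance:
  assumes "binary_code n M {2 * k, 2 * k + 2} C"
  shows "two_distance k n (supp ` C)" "card (supp ` C) = M"
proof -
  have C: "C \<subseteq> carrier_vec n" "card C = M"
    and D: "{hamming_dist u v |u v. u \<in> C \<and> v \<in> C \<and> u \<noteq> v} = {2 * k, 2 * k + 2}"
    using assms unfolding binary_code_def by blast+
  show "card (supp ` C) = M" using card_image[OF inj_on_subset[OF supp_inj C(1)]] C(2) by simp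
  have "card (sym_diff (supp u) (supp v)) \<in> {2 * k, 2 * k + 2}"
    if "u \<in> C" "v \<in> C" "supp u \<noteq> supp v" for u v
  proof -
    have "hamming_dist u v \<in> {2 * k, 2 * k + 2}" using D that by blast
    moreover have "u \<in> carrier_vec n" "v \<in> carrier_vec n" using that C(1) by blast+
    ultimately show ?thesis using hamming_dist_supp by simp
  qed
  moreover have "supp ` C \<subseteq> Pow {..<n}" using C(1) supp_subset by blast
  ultimately show "two_distance k n (supp ` C)" unfolding two_distance_def by blast
qed

text \<open>The size bound yields both disjoint and meeting pairs of blocks, so both distances occur
  and the packing competes for \<open>A2\<close>.\<close>

lemma packing_binary_code:
  assumes P: "packing k n P" and k: "k \<ge> 1" and big: "card P > (k + 1) * n"
  shows "binary_code n (card P) {2 * k, 2 * k + 2} (indicator_vec n ` P)"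
proof -
  have Pn: "B \<subseteq> {..<n}" "card B = k + 1" if "B \<in> P" for B using P that unfolding packing_def by blast+
  have inj: "inj_on (indicator_vec n) P"
    by (rule inj_onI) (metis Pn(1) supp_indicator_vec)
  have hd: "hamming_dist (indicator_vec n A) (indicator_vec n B) + 2 * card (A \<inter> B) = 2 * k + 2"
    if "A \<in> P" "B \<in> P" for A B
  proof -
    have "hamming_dist (indicator_vec n A) (indicator_vec n B) = card (sym_diff A B)"
      using hamming_dist_supp[OF indicator_vec_carrier indicator_vec_carrier]
        supp_indicator_vec[OF Pn(1)[OF that(1)]] supp_indicator_vec[OF Pn(1)[OF that(2)]] by simp
    then show ?thesis
      using card_sym_diff_plus[OF packing_finite_block[OF P that(1)] packing_finite_block[OF P that(2)]]
        Pn(2)[OF that(1)] Pn(2)[OF that(2)] by simp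
  qed
  let ?H = "{hamming_dist u v |u v. u \<in> indicator_vec n ` P \<and> v \<in> indicator_vec n ` P \<and> u \<noteq> v}"
  have "?H = {2 * k, 2 * k + 2}"
  proof
    show "?H \<subseteq> {2 * k, 2 * k + 2}"
    proof
      fix x assume "x \<in> ?H"
      then obtain A B where AB: "A \<in> P" "B \<in> P" "A \<noteq> B" "x = hamming_dist (indicator_vec n A) (indicator_vec n B)"
        by blast
      then have "card (A \<inter> B) \<le> 1" using P unfolding packing_def by blast
      then have "card (A \<inter> B) = 0 \<or> card (A \<inter> B) = 1" by linarith
      then show "x \<in> {2 * k, 2 * k + 2}" using hd[OF AB(1,2)] AB(4) by auto
    qed
    have mem: "hamming_dist (indicator_vec n A) (indicator_vec n B) \<in> ?H" if "A \<in> P" "B \<in> P" "A \<noteq> B" for A B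
      using that inj unfolding inj_on_def by blast
    obtain A B where AB: "A \<in> P" "B \<in> P" "A \<noteq> B" "card (A \<inter> B) = 0"
      using packing_intersections(1)[OF P k big] by blast
    have "hamming_dist (indicator_vec n A) (indicator_vec n B) = 2 * k + 2" using hd[OF AB(1,2)] AB(4) by simp
    then have 1: "2 * k + 2 \<in> ?H" using mem[OF AB(1-3)] by metis
    obtain A' B' where AB': "A' \<in> P" "B' \<in> P" "A' \<noteq> B'" "card (A' \<inter> B') = 1"
      using packing_intersections(2)[OF P k big] by blast
    have "hamming_dist (indicator_vec n A') (indicator_vec n B') = 2 * k" using hd[OF AB'(1,2)] AB'(4) by simp
    then have "2 * k \<in> ?H" using mem[OF AB'(1-3)] by metis
    then show "{2 * k, 2 * k + 2} \<subseteq> ?H" using 1 by blast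
  qed
  moreover have "indicator_vec n ` P \<subseteq> carrier_vec n" using indicator_vec_carrier by blast
  ultimately show ?thesis unfolding binary_code_def using card_image[OF inj] by blast
qed

section \<open>Superlinear packings and the threshold for the length\<close>

text \<open>The line construction with \<open>m = n div L\<close> has \<open>m * m\<close> blocks.
  The bound on \<open>n\<close> makes \<open>m\<close> exceed \<open>(e + 1) * (2 * L)\<close>,
  while \<open>n \<le> 2 * L * m\<close>, so \<open>m * m\<close> beats
  \<open>(e + 1) * n\<close>.\<close>

lemma packing_superlinear_exists:
  fixes k e n :: nat
  assumes k: "k \<ge> 1" and n: "n \<ge> (k + 1) * (k + 1) * ((e + 1) * (2 * ((k + 1) * (k + 1))) + 1)"
  shows "\<exists>P. packing k n P \<and> card P > e * n + 1"
proof -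
  define L where "L = (k + 1) * (k + 1)"
  define m where "m = n div L"
  have L: "L > 0" unfolding L_def by simp
  have n': "n \<ge> ((e + 1) * (2 * L) + 1) * L" using n unfolding L_def by (simp add: mult.commute)
  then have m: "m \<ge> (e + 1) * (2 * L) + 1"
    unfolding m_def using L by (simp add: less_eq_div_iff_mult_less_eq)
  have Lm: "L * m \<le> n" unfolding m_def by simp
  have "n < L * (m + 1)" unfolding m_def using L dividend_less_times_div[of L n] by simp
  also have "\<dots> \<le> L * (2 * m)" using m by (intro mult_left_mono) auto
  finally have nm: "n \<le> 2 * L * m" by simp
  have "((e + 1) * (2 * L) + 1) * L \<ge> 1" using L by simp
  then have "n \<ge> 1" using n' by linarith
  then have "e * n + 1 \<le> (e + 1) * n" by simp
  also have "\<dots> \<le> (e + 1) * (2 * L * m)" using nm by (rule mult_left_mono) simp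
  also have "\<dots> = ((e + 1) * (2 * L)) * m" by (simp only: mult.assoc)
  also have "\<dots> < m * m" using m by (intro mult_strict_right_mono) auto
  finally have "e * n + 1 < m * m" .
  moreover have "(k + 1) * ((k + 1) * m) \<le> n" using Lm unfolding L_def by (simp only: mult.assoc)
  ultimately show ?thesis using packing_quadratic_exists[OF _ k] by metis
qed

theorem theorem2:
  fixes d :: nat
  assumes "even d" and "d > 2"
  shows "\<exists>N::nat. N > 0 \<and>
    (\<forall>n\<ge>N. \<forall>M C. optimal_code n M {d, d + 2} C \<longrightarrow>
      (\<exists>y\<in>carrier_vec n. constant_weight (d div 2 + 1) (translate_code C y)))"
proof -
  obtain k where d: "d = 2 * k" using assms(1) by (elim evenE)
  have k: "k \<ge> 2" using assms(2) d by simp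
  \<comment> \<open>Chosen so that \<open>e * n + 1\<close> is the size threshold of
    \<open>two_distance_optimal\<close>.\<close>
  define e where "e = 2 * (2 ^ (2 * k + 2) * (4 * k + 4))"
  define g where "g = growth k k (k + 1)"
  \<comment> \<open>The first summand provides a packing with more than \<open>e * n + 1\<close>
    blocks, the terms with \<open>growth\<close> allow the two rounds of switching.\<close>
  define N where "N = (k + 1) * (k + 1) * ((e + 1) * (2 * ((k + 1) * (k + 1))) + 1) + g + growth k g (k + 1) + 1"
  have e_ge: "k + 1 \<le> e"
  proof -
    have "4 * k + 4 \<le> 2 ^ (2 * k + 2) * (4 * k + 4)" by simp
    then show ?thesis unfolding e_def by linarith
  qed
  have "\<exists>y\<in>carrier_vec n. constant_weight (d div 2 + 1) (translate_code C y)"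
    if n: "n \<ge> N" and opt: "optimal_code n M {d, d + 2} C" for n M C
  proof -
    have C: "binary_code n M {2 * k, 2 * k + 2} C" and M: "M = A2 n {2 * k, 2 * k + 2}"
      using opt d unfolding optimal_code_def by auto
    have Cn: "C \<subseteq> carrier_vec n" using C unfolding binary_code_def by blast
    have k1: "k \<ge> 1" using k by simp
    have en: "(k + 1) * n \<le> e * n" using e_ge by (intro mult_right_mono) auto
    have le: "card P \<le> M" if "packing k n P" "card P > (k + 1) * n" for P
      using binary_code_le_A2[OF packing_binary_code[OF that(1) k1 that(2)]] M by simp
    have "n \<ge> (k + 1) * (k + 1) * ((e + 1) * (2 * ((k + 1) * (k + 1))) + 1)" using n unfolding N_def by linarith
    from packing_superlinear_exists[OF k1 this] obtain P where "packing k n P" "card P > e * n + 1" by blast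
    then have big: "M > e * n + 1" using le[of P] en by linarith
    \<comment> \<open>A packing with at most \<open>(k + 1) * n\<close> blocks may miss a distance
      and fail to be a code; it is smaller than \<open>C\<close> by size alone.\<close>
    have "card P \<le> card (supp ` C)" if "packing k n P" for P
    proof (cases "card P > (k + 1) * n")
      case True
      then show ?thesis using le[OF that] binary_code_two_distance(2)[OF C] by simp
    next
      case False
      then show ?thesis using big en binary_code_two_distance(2)[OF C] by linarith
    qed
    then have "\<forall>P. packing k n P \<longrightarrow> card P \<le> card (supp ` C)" by blast
    moreover have "card (supp ` C) > 2 * (2 ^ (2 * k + 2) * ((4 * k + 4) * n)) + 1"
      using big binary_code_two_distance(2)[OF C] unfolding e_def by (simp only: mult.assoc)
    moreover have "growth k (growth k k (k + 1)) (k + 1) < n" "growth k k (k + 1) < n"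
      using n unfolding N_def g_def by linarith+
    ultimately obtain Y where Y: "Y \<subseteq> {..<n}" "\<forall>X\<in>supp ` C. card (sym_diff X Y) = k + 1"
      using two_distance_optimal[OF binary_code_two_distance(1)[OF C] k] by blast
    have "hamming_weight (x + indicator_vec n Y) = d div 2 + 1" if "x \<in> C" for x
    proof -
      have "x \<in> carrier_vec n" using that Cn by blast
      then have "supp (x + indicator_vec n Y) = sym_diff (supp x) Y"
        using supp_add[OF _ indicator_vec_carrier] supp_indicator_vec[OF Y(1)] by simp
      then show ?thesis using Y(2) that d unfolding hamming_weight_supp by simp
    qed
    then have "constant_weight (d div 2 + 1) (translate_code C (indicator_vec n Y))"
      unfolding constant_weight_def translate_code_def by blast
    then show ?thesis using indicator_vec_carrier by blast
  qed
  moreover have "N > 0" unfolding N_def by simp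
  ultimately show ?thesis by blast
qed

end
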